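(* Let $n=8k+1$ for some integer $k\ge 1$. Then there is an odd cover of $K_n^{(3)}$ of size $4k$.
   Context: $K_n^{(3)}$ denotes the collection of all $3$-element subsets of an $n$-element vertex set. A complete $3$-partite $3$-graph (on this vertex set) is specified by three pairwise disjoint sets $A_1,A_2,A_3$ of vertices, and consists of those $3$-sets that meet every $A_i$. The sets $A_1,A_2,A_3$ need not cover the vertex set. A set of complete $3$-partite $3$-graphs is an odd cover of $K_n^{(3)}$ if each $3$-set is in an odd number of these complete $3$-partite $3$-graphs. Its size is the number of complete $3$-partite $3$-graphs in it. *)

theory Defs
  imports "HOL-Library.Ramsey"
begin

text \<open>A 3-graph on \<open>V\<close> is represented by its set of edges, a subset of \<^term>\<open>nsets V 3\<close>. The
  parts need not cover \<open>V\<close>, and are allowed to be empty (the 3-graph then has no edges).\<close>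

definition tripartite :: "'a set \<Rightarrow> 'a set \<Rightarrow> 'a set \<Rightarrow> 'a set \<Rightarrow> 'a set set" where
  "tripartite V A1 A2 A3 =
     {e \<in> nsets V 3. e \<inter> A1 \<noteq> {} \<and> e \<inter> A2 \<noteq> {} \<and> e \<inter> A3 \<noteq> {}}"

definition is_complete_tripartite :: "'a set \<Rightarrow> 'a set set \<Rightarrow> bool" where
  "is_complete_tripartite V H \<longleftrightarrow>
     (\<exists>A1 A2 A3. A1 \<subseteq> V \<and> A2 \<subseteq> V \<and> A3 \<subseteq> V \<and>
        A1 \<inter> A2 = {} \<and> A1 \<inter> A3 = {} \<and> A2 \<inter> A3 = {} \<and>
        H = tripartite V A1 A2 A3)"

definition odd_cover :: "'a set \<Rightarrow> 'a set set set \<Rightarrow> bool" where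
  "odd_cover V \<C> \<longleftrightarrow>
     (\<forall>H \<in> \<C>. is_complete_tripartite V H) \<and>
     (\<forall>e \<in> nsets V 3. odd (card {H \<in> \<C>. e \<in> H}))"

end

theory Submission
  imports Defs
begin

text \<open>Label the parts of a complete 3-partite 3-graph covering \<open>V\<close> by the colours 0, 1, 2, and say
  that two vertices clash if their colours are 1 and 2 in some order. Modulo 2, a triple is rainbow
  iff an odd number of its three pairs clash. So it suffices to find \<open>4 * k\<close> colourings of \<open>8 * k\<close>
  vertices in which each pair clashes an odd number of times, and to add one vertex that has
  colour 0 throughout.

  For \<open>k = 1\<close>, take the affine plane over the field with 3 elements, one colouring for each of
  the four parallel classes of lines, and the origin as the additional vertex. In general, take \<open>k\<close> such
  groups of 8 vertices and \<open>k\<close> such blocks of 4 colourings. Outside its own block, a vertex has the same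
  colour in all four colourings of a block, either 1 or 2. Vertices of two groups then clash an even
  number of times (0 or 4) in any third block. The number of clashes of a vertex \<open>x\<close>, within its own block,
  with a constant colour changes parity with that colour, so the colour of \<open>x\<close> in the other blocks can
  be chosen by its own parity, reversed according to the order of the two groups, so as to
  make the number of clashes between groups odd.\<close>

section \<open>Rainbow triples, clashing pairs and odd covers from colourings\<close>

definition clash :: "nat \<Rightarrow> nat \<Rightarrow> bool" where
  "clash p q \<longleftrightarrow> p \<noteq> 0 \<and> q \<noteq> 0 \<and> p \<noteq> q"

lemma clash_commute: "clash p q \<longleftrightarrow> clash q p"
  by (auto simp: clash_def)

lemma le_2_cases: "(p::nat) \<le> 2 \<longleftrightarrow> p = 0 \<or> p = 1 \<or> p = 2"
  by auto

text \<open>A rainbow triple has exactly one clashing pair. In any other triple, either 1 and 2 do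
  not both occur and nothing clashes, or they occupy all three places, split 2 to 1, and two pairs
  clash.\<close>

lemma even_rainbow_plus_clashes:
  assumes "p \<le> 2" "q \<le> 2" "r \<le> 2"
  shows "even (of_bool (distinct [p, q, r]) + of_bool (clash p q) + of_bool (clash q r)
     + of_bool (clash p r) :: nat)"
  using assms by (auto simp: le_2_cases clash_def)

lemma distinct_3_iff:
  assumes "p \<le> 2" "q \<le> 2" "r \<le> (2::nat)"
  shows "distinct [p, q, r] \<longleftrightarrow>
    (p = 0 \<or> q = 0 \<or> r = 0) \<and> (p = 1 \<or> q = 1 \<or> r = 1) \<and> (p = 2 \<or> q = 2 \<or> r = 2)"
  using assms unfolding le_2_cases by (elim disjE) simp_all

lemma mem_tripartite_colour_classes_iff:
  fixes g :: "'a \<Rightarrow> nat"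
  assumes "u \<in> V" "v \<in> V" "w \<in> V" "distinct [u, v, w]"
    and "g u \<le> 2" "g v \<le> 2" "g w \<le> 2"
  shows "{u, v, w} \<in> tripartite V {x \<in> V. g x = 0} {x \<in> V. g x = 1} {x \<in> V. g x = 2}
     \<longleftrightarrow> distinct [g u, g v, g w]"
proof -
  have "card {u, v, w} = 3"
    using assms(4) by simp
  then have edge: "{u, v, w} \<in> nsets V 3"
    using assms(1-3) by (simp add: nsets_def)
  have meets: "{u, v, w} \<inter> {x \<in> V. g x = t} \<noteq> {} \<longleftrightarrow> g u = t \<or> g v = t \<or> g w = t" for t
    using assms(1-3) by auto
  show ?thesis
    unfolding tripartite_def mem_Collect_eq meets distinct_3_iff[OF assms(5-7)]
    by (simp only: edge simp_thms)
qed

text \<open>A cover is a set of 3-graphs, so colourings with equal 3-graphs would be merged;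
  \<open>separated\<close> makes the map from colourings to 3-graphs injective, which preserves both
  the size and the parities.\<close>

lemma odd_cover_of_colourings:
  fixes g :: "'i \<Rightarrow> 'a \<Rightarrow> nat"
  assumes "finite I"
    and range: "\<And>i v. i \<in> I \<Longrightarrow> v \<in> V \<Longrightarrow> g i v \<le> 2"
    and rainbow: "\<And>u v w. u \<in> V \<Longrightarrow> v \<in> V \<Longrightarrow> w \<in> V \<Longrightarrow> distinct [u, v, w] \<Longrightarrow>
      odd (card {i \<in> I. distinct [g i u, g i v, g i w]})"
    and separated: "\<And>i j. i \<in> I \<Longrightarrow> j \<in> I \<Longrightarrow> i \<noteq> j \<Longrightarrow>
      \<exists>u\<in>V. \<exists>v\<in>V. \<exists>w\<in>V. distinct [g i u, g i v, g i w] \<and> \<not> distinct [g j u, g j v, g j w]"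
  shows "\<exists>\<C>. odd_cover V \<C> \<and> card \<C> = card I"
proof -
  define H where
    "H i = tripartite V {x \<in> V. g i x = 0} {x \<in> V. g i x = 1} {x \<in> V. g i x = 2}" for i
  have H_iff: "{u, v, w} \<in> H i \<longleftrightarrow> distinct [g i u, g i v, g i w]"
    if "i \<in> I" "u \<in> V" "v \<in> V" "w \<in> V" "distinct [u, v, w]" for i u v w
    unfolding H_def using that by (intro mem_tripartite_colour_classes_iff range)
  have inj: "inj_on H I"
  proof (rule inj_onI, rule ccontr)
    fix i j assume ij: "i \<in> I" "j \<in> I" "H i = H j" "i \<noteq> j"
    then obtain u v w where uvw: "u \<in> V" "v \<in> V" "w \<in> V"
      "distinct [g i u, g i v, g i w]" "\<not> distinct [g j u, g j v, g j w]"
      using separated by blast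
    then have "distinct [u, v, w]"
      by auto
    then show False
      using H_iff[of i u v w] H_iff[of j u v w] uvw ij by simp
  qed
  have "is_complete_tripartite V (H i)" for i
    unfolding is_complete_tripartite_def H_def
    by (intro exI[of _ "{x \<in> V. g i x = 0}"] exI[of _ "{x \<in> V. g i x = 1}"]
        exI[of _ "{x \<in> V. g i x = 2}"]) auto
  moreover have "odd (card {h \<in> H ` I. e \<in> h})" if "e \<in> nsets V 3" for e
  proof -
    have "e \<subseteq> V" "card e = 3"
      using that by (auto simp: nsets_def)
    then obtain u v w where e: "e = {u, v, w}" "distinct [u, v, w]" "u \<in> V" "v \<in> V" "w \<in> V"
      by (force simp: card_3_iff)
    have "{h \<in> H ` I. e \<in> h} = H ` {i \<in> I. e \<in> H i}"
      by auto
    also have "card \<dots> = card {i \<in> I. e \<in> H i}"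
      by (rule card_image) (rule inj_on_subset[OF inj], auto)
    also have "{i \<in> I. e \<in> H i} = {i \<in> I. distinct [g i u, g i v, g i w]}"
      unfolding e(1) using H_iff[OF _ e(3-5,2)] by (intro Collect_cong conj_cong) auto
    finally show ?thesis
      using rainbow[OF e(3-5,2)] by simp
  qed
  ultimately have "odd_cover V (H ` I)"
    by (auto simp: odd_cover_def)
  then show ?thesis
    using card_image[OF inj] by blast
qed

definition clashes :: "'i set \<Rightarrow> ('i \<Rightarrow> 'a \<Rightarrow> nat) \<Rightarrow> 'a \<Rightarrow> 'a \<Rightarrow> nat" where
  "clashes I g u v = (\<Sum>i\<in>I. of_bool (clash (g i u) (g i v)))"

lemma clashes_commute: "clashes I g u v = clashes I g v u"
  unfolding clashes_def by (simp add: clash_commute)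

lemma odd_card_rainbow_iff:
  assumes "finite I" and "\<And>i. i \<in> I \<Longrightarrow> g i u \<le> 2 \<and> g i v \<le> 2 \<and> g i w \<le> 2"
  shows "odd (card {i \<in> I. distinct [g i u, g i v, g i w]})
    \<longleftrightarrow> odd (clashes I g u v + clashes I g v w + clashes I g u w)"
proof -
  have "card {i \<in> I. distinct [g i u, g i v, g i w]}
      = (\<Sum>i\<in>I. of_bool (distinct [g i u, g i v, g i w]))"
    using assms(1) by (simp add: Int_def)
  then have "card {i \<in> I. distinct [g i u, g i v, g i w]}
      + clashes I g u v + clashes I g v w + clashes I g u w
    = (\<Sum>i\<in>I. of_bool (distinct [g i u, g i v, g i w]) + of_bool (clash (g i u) (g i v))
        + of_bool (clash (g i v) (g i w)) + of_bool (clash (g i u) (g i w)))"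
    unfolding clashes_def by (simp only: sum.distrib)
  also have "even \<dots>"
    by (rule dvd_sum) (rule even_rainbow_plus_clashes; use assms(2) in blast)
  finally show ?thesis
    by (simp only: even_add add.assoc)
qed

section \<open>The affine plane of order 3\<close>

text \<open>The points of the affine plane are the numbers \<open>0, \<dots>, 8\<close> in base 3; \<open>plane c\<close> is constant
  on the lines of one direction.\<close>

definition plane :: "nat \<Rightarrow> nat \<Rightarrow> nat" where
  "plane c x = (if c = 0 then x div 3 else (x mod 3 + c * (x div 3)) mod 3)"

definition plane_parity :: "nat \<Rightarrow> bool" where
  "plane_parity x \<longleftrightarrow> odd (\<Sum>c<4. of_bool (plane c x = 2) :: nat)"

lemma sum_lessThan_4: "(\<Sum>c<4. f c) = f 0 + f 1 + f 2 + f (3::nat)"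
  by (simp add: eval_nat_numeral)

lemma ball_plane: "(\<forall>x\<in>{1..8::nat}. P x) \<longleftrightarrow> P 1 \<and> P 2 \<and> P 3 \<and> P 4 \<and> P 5 \<and> P 6 \<and> P 7 \<and> P 8"
proof -
  have "{1..8::nat} = {1, 2, 3, 4, 5, 6, 7, 8}"
    by auto
  then show ?thesis
    by simp
qed

lemma plane_le: "x \<in> {1..8} \<Longrightarrow> plane c x \<le> 2"
  by (auto simp: plane_def)

text \<open>Each \<open>plane c\<close> is a linear form over the field with 3 elements,
  \<open>c = 3\<close> being slope 0. It clashes at \<open>x\<close> and \<open>y\<close> iff it
  vanishes at their vector sum but not at \<open>x\<close>. If \<open>y\<close> is the negative of
  \<open>x\<close>, this holds for three of the four forms. Otherwise only one form vanishes at the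
  sum, and it is nonzero at \<open>x\<close>, as \<open>x\<close> and \<open>y\<close> are not on a
  common line through the origin.\<close>

lemma odd_clashes_plane:
  assumes "x \<in> {1..8}" "y \<in> {1..8}" "x \<noteq> y"
  shows "odd (clashes {..<4} plane x y)"
proof -
  have "\<forall>x\<in>{1..8}. \<forall>y\<in>{1..8}. x \<noteq> y \<longrightarrow> odd (clashes {..<4} plane x y)"
    unfolding ball_plane
    by (simp add: clashes_def plane_def clash_def sum_lessThan_4)
  with assms show ?thesis
    by blast
qed

text \<open>Constant 1 clashes with the values 2, constant 2 with the values 1. Exactly one form
  vanishes at a point other than the origin, so the two counts add up to 3 and have opposite
  parities.\<close>

lemma odd_clashes_plane_const:
  assumes "x \<in> {1..8}"
  shows "odd (\<Sum>c<4. of_bool (clash (plane c x) (if b then 1 else 2)) :: nat)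
    \<longleftrightarrow> (plane_parity x \<longleftrightarrow> b)"
proof -
  have "\<forall>x\<in>{1..8}. odd (\<Sum>c<4. of_bool (clash (plane c x) (if b then 1 else 2)) :: nat)
    \<longleftrightarrow> (plane_parity x \<longleftrightarrow> b)"
    unfolding ball_plane
    by (simp add: plane_parity_def plane_def clash_def sum_lessThan_4)
  with assms show ?thesis
    by blast
qed

lemma plane_rainbow:
  assumes "c < 4"
  shows "\<exists>x\<in>{1..8}. \<exists>y\<in>{1..8}. \<exists>z\<in>{1..8}. distinct [plane c x, plane c y, plane c z]"
proof -
  consider "c = 0" | "c = 1" | "c = 2" | "c = 3"
    using assms by linarith
  then show ?thesis
  proof cases
    case 1
    then show ?thesis
      by (intro bexI[of _ 1] bexI[of _ 3] bexI[of _ 6]) (simp_all add: plane_def)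
  next
    case 2
    then show ?thesis
      by (intro bexI[of _ 1] bexI[of _ 2] bexI[of _ 5]) (simp_all add: plane_def)
  next
    case 3
    then show ?thesis
      by (intro bexI[of _ 1] bexI[of _ 2] bexI[of _ 4]) (simp_all add: plane_def)
  next
    case 4
    then show ?thesis
      by (intro bexI[of _ 1] bexI[of _ 2] bexI[of _ 3]) (simp_all add: plane_def)
  qed
qed

lemma plane_separated:
  assumes "c < 4" "d < 4" "c \<noteq> d"
  shows "\<exists>x\<in>{1..8}. \<exists>y\<in>{1..8}. distinct [0, plane c x, plane c y] \<and> plane d x = 0"
proof -
  \<comment> \<open>The origin, \<open>p\<close> and \<open>q\<close> form the line of direction
    \<open>d\<close> through the origin. Any other direction separates its three points.\<close>
  define p where "p = (if d = 0 then 1 else if d = 1 then 5 else if d = 2 then 4 else 3::nat)"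
  define q where "q = (if d = 0 then 2 else if d = 1 then 7 else if d = 2 then 8 else 6::nat)"
  have "c \<in> {0, 1, 2, 3}" "d \<in> {0, 1, 2, 3}"
    using assms by auto
  with assms show ?thesis
    by (intro bexI[of _ p] bexI[of _ q]) (auto simp: p_def q_def plane_def)
qed

section \<open>Combining groups and blocks\<close>

text \<open>Vertex \<open>Some (j, x)\<close> is the point \<open>x\<close> of group \<open>j\<close>, and colouring \<open>(m, c)\<close> is the \<open>c\<close>-th one of
  block \<open>m\<close>.\<close>

fun colour :: "nat \<times> nat \<Rightarrow> (nat \<times> nat) option \<Rightarrow> nat" where
  "colour (m, c) None = 0"
| "colour (m, c) (Some (j, x)) =
     (if m = j then plane c x else if plane_parity x \<longleftrightarrow> m < j then 1 else 2)"

lemma clashes_colour_None: "clashes I colour None v = 0" "clashes I colour v None = 0"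
proof -
  have "colour i None = 0" for i
    by (cases i) simp
  then show "clashes I colour None v = 0" "clashes I colour v None = 0"
    by (simp_all add: clashes_def clash_def)
qed

lemma clashes_colour_blocks:
  "clashes ({..<k} \<times> {..<4}) colour u v
    = (\<Sum>m<k. \<Sum>c<4. of_bool (clash (colour (m, c) u) (colour (m, c) v)))"
  unfolding clashes_def sum.cartesian_product by (intro sum.cong) auto

lemma even_clashes_foreign_block:
  assumes "m \<noteq> j" "m \<noteq> l"
  shows "even (\<Sum>c<4. of_bool (clash (colour (m, c) (Some (j, x))) (colour (m, c) (Some (l, y)))) :: nat)"
  using assms by simp

lemma odd_clashes_same_group:
  assumes "j < k" "x \<in> {1..8}" "y \<in> {1..8}" "x \<noteq> y"
  shows "odd (clashes ({..<k} \<times> {..<4}) colour (Some (j, x)) (Some (j, y)))"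
proof -
  define s where "s m =
    (\<Sum>c<4. of_bool (clash (colour (m, c) (Some (j, x))) (colour (m, c) (Some (j, y)))) :: nat)" for m
  have split: "clashes ({..<k} \<times> {..<4}) colour (Some (j, x)) (Some (j, y)) = s j + sum s ({..<k} - {j})"
    unfolding clashes_colour_blocks s_def[symmetric] using assms(1) by (intro sum.remove) auto
  have "even (sum s ({..<k} - {j}))"
    unfolding s_def by (intro dvd_sum even_clashes_foreign_block) auto
  moreover have "odd (s j)"
    using odd_clashes_plane[OF assms(2-4)] by (simp add: clashes_def s_def)
  ultimately show ?thesis
    unfolding split even_add by blast
qed

lemma odd_clashes_distinct_groups:
  assumes "j < l" "l < k" "x \<in> {1..8}" "y \<in> {1..8}"
  shows "odd (clashes ({..<k} \<times> {..<4}) colour (Some (j, x)) (Some (l, y)))"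
proof -
  define s where "s m =
    (\<Sum>c<4. of_bool (clash (colour (m, c) (Some (j, x))) (colour (m, c) (Some (l, y)))) :: nat)" for m
  have "clashes ({..<k} \<times> {..<4}) colour (Some (j, x)) (Some (l, y)) = s j + sum s ({..<k} - {j})"
    unfolding clashes_colour_blocks s_def[symmetric] using assms by (intro sum.remove) auto
  also have "sum s ({..<k} - {j}) = s l + sum s ({..<k} - {j} - {l})"
    using assms by (intro sum.remove) auto
  finally have split: "clashes ({..<k} \<times> {..<4}) colour (Some (j, x)) (Some (l, y))
    = s j + (s l + sum s ({..<k} - {j} - {l}))" .
  have "even (sum s ({..<k} - {j} - {l}))"
    unfolding s_def by (intro dvd_sum even_clashes_foreign_block) auto
  \<comment> \<open>As \<open>j < l\<close>, in block \<open>j\<close> the second vertex has colour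
    1 iff \<open>plane_parity y\<close>, while in block \<open>l\<close> the first has colour 1 iff
    not \<open>plane_parity x\<close>. Hence exactly one of \<open>s j\<close> and
    \<open>s l\<close> is odd.\<close>
  moreover have "odd (s j) \<longleftrightarrow> (plane_parity x \<longleftrightarrow> plane_parity y)"
    using odd_clashes_plane_const[OF assms(3), of "plane_parity y"] assms(1) by (simp add: s_def)
  moreover have "odd (s l) \<longleftrightarrow> (plane_parity y \<longleftrightarrow> \<not> plane_parity x)"
    using odd_clashes_plane_const[OF assms(4), of "\<not> plane_parity x"] assms(1)
    by (simp add: s_def clash_commute)
  ultimately show ?thesis
    unfolding split even_add by blast
qed

lemma odd_clashes_colour:
  assumes "u \<in> {..<k} \<times> {1..8}" "v \<in> {..<k} \<times> {1..8}" "u \<noteq> v"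
  shows "odd (clashes ({..<k} \<times> {..<4}) colour (Some u) (Some v))"
proof -
  obtain j x l y where uv: "u = (j, x)" "v = (l, y)"
    by fastforce
  consider "j = l" | "j < l" | "l < j"
    by linarith
  then show ?thesis
  proof cases
    case 1
    with assms uv odd_clashes_same_group[of l k x y] show ?thesis
      by auto
  next
    case 2
    with assms uv odd_clashes_distinct_groups[of j l k x y] show ?thesis
      by auto
  next
    case 3
    with assms uv odd_clashes_distinct_groups[of l j k y x] show ?thesis
      by (subst clashes_commute) auto
  qed
qed

section \<open>The odd cover on the combined vertex set and its transfer to \<open>V\<close>\<close>

definition vertices :: "nat \<Rightarrow> (nat \<times> nat) option set" where
  "vertices k = insert None (Some ` ({..<k} \<times> {1..8}))"

lemma card_vertices: "card (vertices k) = 8 * k + 1"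
  by (simp add: vertices_def card_image card_cartesian_product image_iff)

lemma colour_le: "v \<in> vertices k \<Longrightarrow> colour i v \<le> 2"
  using plane_le by (cases i) (auto simp: vertices_def)

lemma odd_rainbow_colourings:
  assumes "u \<in> vertices k" "v \<in> vertices k" "w \<in> vertices k" "distinct [u, v, w]"
  shows "odd (card {i \<in> {..<k} \<times> {..<4}. distinct [colour i u, colour i v, colour i w]})"
proof -
  let ?N = "clashes ({..<k} \<times> {..<4}) colour"
  have odd: "odd (?N s t) \<longleftrightarrow> s \<noteq> None \<and> t \<noteq> None"
    if st: "s \<in> vertices k" "t \<in> vertices k" "s \<noteq> t" for s t
  proof (cases "s = None \<or> t = None")
    case True
    then show ?thesis
      using clashes_colour_None by auto
  next
    case False
    then obtain p q where "s = Some p" "t = Some q" "p \<in> {..<k} \<times> {1..8}" "q \<in> {..<k} \<times> {1..8}"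
      using st(1,2) unfolding vertices_def by blast
    then show ?thesis
      using odd_clashes_colour[of p k q] st(3) by simp
  qed
  \<comment> \<open>At most one of the three vertices is \<open>None\<close>, so the number of odd
    summands is three or one.\<close>
  have "odd (?N u v + ?N v w + ?N u w)"
    using assms odd[of u v] odd[of v w] odd[of u w] by (cases u; cases v; cases w) auto
  then show ?thesis
    by (subst odd_card_rainbow_iff) (use assms colour_le in auto)
qed

lemma colourings_separated:
  assumes "i \<in> {..<k} \<times> {..<4}" "j \<in> {..<k} \<times> {..<4}" "i \<noteq> j"
  shows "\<exists>u\<in>vertices k. \<exists>v\<in>vertices k. \<exists>w\<in>vertices k.
    distinct [colour i u, colour i v, colour i w] \<and> \<not> distinct [colour j u, colour j v, colour j w]"
proof -
  obtain m c l d where ij: "i = (m, c)" "j = (l, d)"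
    by fastforce
  show ?thesis
  proof (cases "l = m")
    case True
    with assms ij obtain x y where xy: "x \<in> {1..8}" "y \<in> {1..8}"
      "distinct [0, plane c x, plane c y]" "plane d x = 0"
      using plane_separated[of c d] by auto
    with True assms ij show ?thesis
      by (intro bexI[of _ None] bexI[of _ "Some (m, x)"] bexI[of _ "Some (m, y)"])
        (auto simp: vertices_def)
  next
    case False
    from assms ij obtain x y z where xyz: "x \<in> {1..8}" "y \<in> {1..8}" "z \<in> {1..8}"
      "distinct [plane c x, plane c y, plane c z]"
      using plane_rainbow[of c] by auto
    \<comment> \<open>In a block other than \<open>m\<close>, the vertices of group \<open>m\<close>
      only have colours 1 and 2, so no three of them are rainbow.\<close>
    with False assms ij show ?thesis
      by (intro bexI[of _ "Some (m, x)"] bexI[of _ "Some (m, y)"] bexI[of _ "Some (m, z)"])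
        (auto simp: vertices_def)
  qed
qed

theorem theorem5:
  fixes V :: "'a set" and n k :: nat
  assumes "k \<ge> 1" and "n = 8 * k + 1"
    and "finite V" and "card V = n"
  shows "\<exists>\<C>. odd_cover V \<C> \<and> card \<C> = 4 * k"
proof -
  have "finite (vertices k)" "card V = card (vertices k)"
    using assms(2,4) by (simp_all add: card_vertices) (simp add: vertices_def)
  then obtain f where f: "bij_betw f V (vertices k)"
    using finite_same_card_bij[OF assms(3)] by blast
  then have f_in: "f v \<in> vertices k" if "v \<in> V" for v
    using that by (rule bij_betw_apply)
  have f_surj: "\<exists>v\<in>V. f v = u" if "u \<in> vertices k" for u
    using f that by (metis bij_betw_iff_bijections)
  have f_inj: "f u = f v \<longleftrightarrow> u = v" if "u \<in> V" "v \<in> V" for u v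
    using f that by (auto simp: bij_betw_def inj_on_eq_iff)
  have "\<exists>\<C>. odd_cover V \<C> \<and> card \<C> = card ({..<k} \<times> {..<4::nat})"
  proof (rule odd_cover_of_colourings[where g = "\<lambda>i v. colour i (f v)"])
    show "colour i (f v) \<le> 2" if "v \<in> V" for i v
      using that f_in colour_le by blast
    show "odd (card {i \<in> {..<k} \<times> {..<4}. distinct [colour i (f u), colour i (f v), colour i (f w)]})"
      if "u \<in> V" "v \<in> V" "w \<in> V" "distinct [u, v, w]" for u v w
      by (rule odd_rainbow_colourings) (use that f_in f_inj in auto)
    show "\<exists>u\<in>V. \<exists>v\<in>V. \<exists>w\<in>V. distinct [colour i (f u), colour i (f v), colour i (f w)]
        \<and> \<not> distinct [colour j (f u), colour j (f v), colour j (f w)]"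
      if "i \<in> {..<k} \<times> {..<4}" "j \<in> {..<k} \<times> {..<4}" "i \<noteq> j" for i j
      using colourings_separated[OF that] f_surj by metis
  qed simp
  then show ?thesis
    by (simp add: mult.commute)
qed

end
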